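(* Let $1\le m<n$, let $\lambda_1<\dots<\lambda_n$ be real numbers in an open interval $(a,b)$, and let $w_1,\dots,w_n\in\mathbb{C}\setminus\{0\}$. Let $s\in\mathbb{R}$ be distinct from $\lambda_1,\dots,\lambda_n$, and let $\theta_1<\dots<\theta_m$ in $(a,b)$, all distinct from $s$, and $c_1,\dots,c_m\in\mathbb{C}$ satisfy the rational Gaussian quadrature property $$\sum_{j=1}^n |w_j|^2\, r(\lambda_j)=\sum_{j=1}^m |c_j|^2\, r(\theta_j)\qquad\text{for all } r(\lambda)=\frac{p(\lambda)}{(\lambda-s)^{2m-2}},\ p\in\Pi_{2m-2}.$$ Let $k_m$, the index sets $I_k\subset\{1,\dots,m\}$, the sets $R_k\subset\mathbb{R}$ ($k=1,\dots,m$) and the measure $\mu_n$ be as defined in the context, and put $R_{m+1}:=R_1$. Then $$\mu_n(R_k)<\sum_{j\in I_k}|c_j|^2<\mu_n(R_{k+1}^{\mathrm{o}})\qquad\text{for all } k\in\{1,\dots,m\}\setminus\{k_m\}.$$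
   Context: $\Pi_j$ denotes the complex polynomials of degree $\le j$. For a set $R$ of real numbers, $\mu_n(R)=\sum_{j:\ \lambda_j\in R}|w_j|^2$, and $R^{\mathrm{o}}$ denotes the interior of $R$. The left-hand side of the quadrature property is the Riemann-Stieltjes integral $\int_a^b r\,\mathrm{d}\alpha_n$ for the step function $\alpha_n(\lambda)=\sum_{j:\lambda_j\le\lambda}|w_j|^2$. Indices: if $s\in(\theta_1,\theta_m)$, then $k_m$ and $k_1$ are defined by $\theta_{k_m}<s<\theta_{k_1}$, $k_1=k_m+1$. If $s<\theta_1$ or $s>\theta_m$, then $k_1=1$ and $k_m=m$. Sets, for $k=1,\dots,m$: $I_k=\{k_1,\dots,k\}$ if $k_1\le k\le m$, and $I_k=\{1,\dots,k\}\cup\{k_1,\dots,m\}$ if $1\le k<k_1$; $R_k=(s,\theta_k]$ if $\theta_k>s$, and $R_k=(a,\theta_k]\cup(s,b)$ if $\theta_k<s$ (where $(s,b)=\emptyset$ if $s\ge b$). *)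

theory Defs
  imports "HOL-Analysis.Analysis" "HOL-Computational_Algebra.Polynomial"
begin

text \<open>
  Finite sequences are functions on \<open>nat\<close>, used at the indices \<open>1, \<dots>, n\<close> (\<open>lam\<close>, \<open>w\<close>) and
  \<open>1, \<dots>, m\<close> (\<open>\<theta>\<close>, \<open>c\<close>).  The endpoints of the open interval \<open>(a,b)\<close> are extended reals,
  so that unbounded intervals are included.
\<close>

definition mu :: "nat \<Rightarrow> (nat \<Rightarrow> real) \<Rightarrow> (nat \<Rightarrow> complex) \<Rightarrow> real set \<Rightarrow> real" where
  "mu n lam w R = (\<Sum>j\<in>{j\<in>{1..n}. lam j \<in> R}. (cmod (w j))\<^sup>2)"

text \<open>
  The description in \<open>THE\<close> is proper whenever \<open>\<theta>\<close> is strictly increasing on \<open>{1..m}\<close>, avoids \<open>s\<close>,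
  and \<open>\<theta> 1 < s < \<theta> m\<close>.
\<close>

definition k_last :: "nat \<Rightarrow> real \<Rightarrow> (nat \<Rightarrow> real) \<Rightarrow> nat" where
  "k_last m s \<theta> =
     (if \<theta> 1 < s \<and> s < \<theta> m
      then (THE k. k \<in> {1..<m} \<and> \<theta> k < s \<and> s < \<theta> (k + 1))
      else m)"

definition k_first :: "nat \<Rightarrow> real \<Rightarrow> (nat \<Rightarrow> real) \<Rightarrow> nat" where
  "k_first m s \<theta> = (if \<theta> 1 < s \<and> s < \<theta> m then k_last m s \<theta> + 1 else 1)"

definition I_set :: "nat \<Rightarrow> real \<Rightarrow> (nat \<Rightarrow> real) \<Rightarrow> nat \<Rightarrow> nat set" where
  "I_set m s \<theta> k =
     (if k_first m s \<theta> \<le> k then {k_first m s \<theta>..k}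
      else {1..k} \<union> {k_first m s \<theta>..m})"

text \<open>The index \<open>m + 1\<close> stands for the index \<open>1\<close>, by the cyclic convention for these sets.\<close>

definition R_set :: "ereal \<Rightarrow> ereal \<Rightarrow> nat \<Rightarrow> real \<Rightarrow> (nat \<Rightarrow> real) \<Rightarrow> nat \<Rightarrow> real set" where
  "R_set a b m s \<theta> k =
     (let i = (if k = m + 1 then 1 else k) in
      if s < \<theta> i then {s<..\<theta> i}
      else {x. a < ereal x \<and> x \<le> \<theta> i} \<union> einterval (ereal s) b)"

end

theory Submission
  imports Defs
begin

text \<open>
  The substitution \<open>t = 1 / (s - \<lambda>)\<close> turns \<open>p(\<lambda>) / (\<lambda> - s)\<^sup>2\<^sup>m\<^sup>-\<^sup>2\<close> into an arbitrary polynomial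
  in \<open>t\<close> of degree at most \<open>2m - 2\<close> and sends the cyclic order that starts at \<open>s\<close> to the usual order
  of the reals.  The claim then is the Chebyshev--Markov--Stieltjes separation for a quadrature with
  \<open>m\<close> nodes and exactness \<open>2m - 2\<close>: some polynomial of that degree agrees with the step function
  that jumps at the \<open>k\<close>-th node at all nodes and lies strictly above it elsewhere, and \<open>n > m\<close> leaves
  some \<open>\<lambda>\<^sub>j\<close> off the nodes.
\<close>

section \<open>Rolle zeros and the sign of the leading coefficient\<close>

text \<open>Points are added in increasing order. The mean value theorem between the old maximum and
  the new point yields a zero beyond all earlier ones, so no two coincide and the count is exact.
  Disjointness from \<open>S\<close> allows critical points prescribed inside \<open>S\<close> to be
  counted in addition.\<close>

lemma poly_Rolle_finite:
  fixes p :: "real poly"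
  assumes "finite S" and "\<And>x. x \<in> S \<Longrightarrow> poly p x = v"
  shows "\<exists>Z. finite Z \<and> card Z = card S - 1 \<and> Z \<inter> S = {} \<and>
           (\<forall>z\<in>Z. (\<exists>x\<in>S. x < z) \<and> (\<exists>y\<in>S. z < y) \<and> poly (pderiv p) z = 0)"
  using assms
proof (induction S rule: finite_linorder_max_induct)
  case empty
  then show ?case by auto
next
  case (insert b A)
  show ?case
  proof (cases "A = {}")
    case True
    then show ?thesis by (intro exI[of _ "{}"]) auto
  next
    case False
    obtain Z where Z: "finite Z" "card Z = card A - 1" "Z \<inter> A = {}"
      "\<And>z. z \<in> Z \<Longrightarrow> (\<exists>x\<in>A. x < z) \<and> (\<exists>y\<in>A. z < y) \<and> poly (pderiv p) z = 0"
      using insert.IH insert.prems by (metis insertCI)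
    define M where "M = Max A"
    have M: "M \<in> A" "\<And>x. x \<in> A \<Longrightarrow> x \<le> M"
      using False insert.hyps(1) by (auto simp: M_def)
    have "M < b" using M insert.hyps by auto
    moreover have "poly p b - poly p M = 0" using insert.prems M by auto
    ultimately obtain \<xi> where \<xi>: "M < \<xi>" "\<xi> < b" "poly (pderiv p) \<xi> = 0"
      using poly_MVT[of M b p] by force
    have "\<xi> \<notin> Z" using Z(4)[of \<xi>] M(2) \<xi>(1) by force
    moreover have "b \<notin> Z" using Z(4)[of b] insert.hyps by force
    moreover have "\<xi> \<notin> A" using M(2) \<xi>(1) by force
    moreover have "b \<notin> A" using insert.hyps by auto
    moreover have "card A > 0" using False insert.hyps(1) by (simp add: card_gt_0_iff)
    ultimately show ?thesis
      using Z \<xi> M insert.hyps(1) by (intro exI[of _ "insert \<xi> Z"]) auto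
  qed
qed

text \<open>The product is monic of degree \<open>card Z\<close>, so subtracting the multiple
  cancels the coefficient there. The difference has degree below \<open>card Z\<close> but vanishes
  on \<open>Z\<close>, hence is zero. No exact degree of \<open>p\<close> is assumed, so its leading
  coefficient may turn out to be 0.\<close>

lemma poly_eq_smult_prod_roots:
  fixes p :: "'a::idom poly"
  assumes "finite Z" and "degree p \<le> card Z" and "\<And>z. z \<in> Z \<Longrightarrow> poly p z = 0"
  shows "p = smult (coeff p (card Z)) (\<Prod>z\<in>Z. [:- z, 1:])"
proof (rule ccontr)
  define g where "g = p - smult (coeff p (card Z)) (\<Prod>z\<in>Z. [:- z, 1:])"
  have degP: "degree (\<Prod>z\<in>Z. [:- z, 1:]) = card Z"
    using assms(1) by (subst degree_prod_sum_eq) auto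
  have "lead_coeff (\<Prod>z\<in>Z. [:- z, 1:]) = 1"
    by (simp add: lead_coeff_prod)
  then have cg: "coeff g (card Z) = 0" by (simp add: g_def degP)
  have dg: "degree g \<le> card Z"
    unfolding g_def by (intro degree_diff_le assms) (simp add: degP)
  assume "\<not> ?thesis"
  then have "g \<noteq> 0" by (simp add: g_def)
  have "Z \<subseteq> {x. poly g x = 0}"
    using assms by (auto simp: g_def poly_prod intro!: prod_zero)
  then have "card Z \<le> degree g"
    using card_poly_roots_bound[OF \<open>g \<noteq> 0\<close>] poly_roots_finite[OF \<open>g \<noteq> 0\<close>]
    by (meson card_mono order_trans)
  with dg cg \<open>g \<noteq> 0\<close> show False by (metis le_antisym leading_coeff_0_iff)
qed

lemma prod_negative_eq:
  fixes f :: "'a \<Rightarrow> real"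
  shows "(\<Prod>z\<in>U. f z) = (- 1) ^ card U * (\<Prod>z\<in>U. - f z)"
  by (induction U rule: infinite_finite_induct) auto

text \<open>
  By Rolle, the derivative already has as many zeros as its degree allows, so all of them are
  simple and its sign in the gap between \<open>A\<close> and \<open>B\<close> determines the leading coefficient.
\<close>

lemma step_poly_lead_coeff_sign:
  fixes f :: "real poly"
  assumes fin: "finite A" "finite B" and ne: "A \<noteq> {}" "B \<noteq> {}"
    and sep: "\<And>x y. x \<in> A \<Longrightarrow> y \<in> B \<Longrightarrow> x < y"
    and fA: "\<And>x. x \<in> A \<Longrightarrow> poly f x = 1" and fB: "\<And>x. x \<in> B \<Longrightarrow> poly f x = 0"
    and D: "D \<subseteq> A \<union> B" and fD: "\<And>x. x \<in> D \<Longrightarrow> poly (pderiv f) x = 0"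
    and N: "N = card A + card B - 2 + card D" and deg: "degree f \<le> Suc N"
  shows "(- 1) ^ (card (D \<inter> B) + card B) * coeff f (Suc N) > 0"
proof -
  have finD: "finite D" using D fin finite_subset by blast
  obtain ZA where ZA: "finite ZA" "card ZA = card A - 1" "ZA \<inter> A = {}"
    "\<And>z. z \<in> ZA \<Longrightarrow> (\<exists>x\<in>A. x < z) \<and> (\<exists>y\<in>A. z < y) \<and> poly (pderiv f) z = 0"
    using poly_Rolle_finite[of A f 1] fin fA by metis
  obtain ZB where ZB: "finite ZB" "card ZB = card B - 1" "ZB \<inter> B = {}"
    "\<And>z. z \<in> ZB \<Longrightarrow> (\<exists>x\<in>B. x < z) \<and> (\<exists>y\<in>B. z < y) \<and> poly (pderiv f) z = 0"
    using poly_Rolle_finite[of B f 0] fin fB by metis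
  define M L where "M = Max A" and "L = Min B"
  have M: "M \<in> A" "\<And>x. x \<in> A \<Longrightarrow> x \<le> M" using fin ne by (auto simp: M_def)
  have L: "L \<in> B" "\<And>x. x \<in> B \<Longrightarrow> L \<le> x" using fin ne by (auto simp: L_def)
  have "M < L" using sep M L by auto
  \<comment> \<open>\<open>f\<close> drops from 1 at the last point of \<open>A\<close> to 0 at the
    first point of \<open>B\<close>, so its derivative is negative somewhere in the gap.\<close>
  then obtain t where t: "M < t" "t < L" "poly f L - poly f M = (L - M) * poly (pderiv f) t"
    using poly_MVT by blast
  have neg: "poly (pderiv f) t < 0"
  proof -
    have "(L - M) * poly (pderiv f) t = -1" using t fA[OF M(1)] fB[OF L(1)] by simp
    with \<open>M < L\<close> show ?thesis by (smt (verit) mult_nonneg_nonneg)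
  qed
  \<comment> \<open>The known zeros of the derivative are sorted by their side of \<open>t\<close>:
    \<open>U\<close> to the right, \<open>V\<close> to the left.\<close>
  define U V where "U = ZB \<union> (D \<inter> B)" and "V = ZA \<union> (D \<inter> A)"
  have U: "\<And>z. z \<in> U \<Longrightarrow> t < z" using ZB(4) L(2) t unfolding U_def by fastforce
  have V: "\<And>z. z \<in> V \<Longrightarrow> z < t" using ZA(4) M(2) t unfolding V_def by fastforce
  have finUV: "finite U" "finite V" using ZA ZB finD by (auto simp: U_def V_def)
  have UV: "U \<inter> V = {}" using U V by fastforce
  have cU: "card U = card B - 1 + card (D \<inter> B)"
    unfolding U_def using ZB finD by (subst card_Un_disjoint) auto
  have cV: "card V = card A - 1 + card (D \<inter> A)"
    unfolding V_def using ZA finD by (subst card_Un_disjoint) auto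
  have "card D = card (D \<inter> A) + card (D \<inter> B)"
  proof -
    have "(D \<inter> A) \<inter> (D \<inter> B) = {}" using sep by fastforce
    moreover have "D = (D \<inter> A) \<union> (D \<inter> B)" using D by auto
    ultimately show ?thesis using finD by (metis card_Un_disjoint finite_Int)
  qed
  moreover have "card A > 0" and cB: "card B > 0" using fin ne by (auto simp: card_gt_0_iff)
  \<comment> \<open>Rolle gives \<open>card A - 1\<close> and \<open>card B - 1\<close> zeros, and
    \<open>D\<close> adds \<open>card D\<close> more. These are \<open>N\<close> in all, the largest
    possible degree of \<open>pderiv f\<close>, which therefore factors completely.\<close>
  ultimately have card: "card (U \<union> V) = N"
    using cU cV N by (subst card_Un_disjoint[OF finUV UV]) simp
  have eq: "pderiv f = smult (coeff (pderiv f) N) (\<Prod>z\<in>U \<union> V. [:- z, 1:])"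
  proof -
    have "degree (pderiv f) \<le> card (U \<union> V)" using deg card by (simp add: degree_pderiv)
    moreover have "\<And>z. z \<in> U \<union> V \<Longrightarrow> poly (pderiv f) z = 0"
      using ZA(4) ZB(4) fD by (auto simp: U_def V_def)
    ultimately show ?thesis using poly_eq_smult_prod_roots[of "U \<union> V"] finUV card by auto
  qed
  have "poly (pderiv f) t = real (Suc N) * coeff f (Suc N) * (\<Prod>z\<in>U \<union> V. t - z)"
    by (subst eq) (simp add: poly_prod coeff_pderiv)
  also have "(\<Prod>z\<in>U \<union> V. t - z) = (\<Prod>z\<in>U. t - z) * (\<Prod>z\<in>V. t - z)"
    by (rule prod.union_disjoint[OF finUV UV])
  \<comment> \<open>Only the zeros to the right of \<open>t\<close> contribute negative
    factors.\<close>
  also have "(\<Prod>z\<in>U. t - z) = (- 1) ^ card U * (\<Prod>z\<in>U. z - t)"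
    by (subst prod_negative_eq) simp
  finally have "((- 1) ^ card U * coeff f (Suc N)) *
      (real (Suc N) * (\<Prod>z\<in>U. z - t) * (\<Prod>z\<in>V. t - z)) < 0"
    using neg by (simp add: mult_ac)
  moreover have "real (Suc N) * (\<Prod>z\<in>U. z - t) * (\<Prod>z\<in>V. t - z) > 0"
    using U V by (intro mult_pos_pos prod_pos) auto
  ultimately have "(- 1) ^ card U * coeff f (Suc N) < 0"
    using mult_less_0_iff by (metis less_asym)
  \<comment> \<open>The exponent in the claim exceeds \<open>card U\<close> by one, which turns the
    negative sign into a positive one.\<close>
  moreover have "card (D \<inter> B) + card B = Suc (card U)" using cU cB by simp
  ultimately show ?thesis by simp
qed

section \<open>Hermite interpolation and a polynomial above the step function\<close>

text \<open>The correction term of Hermite interpolation: adding a multiple of it changes neither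
  the value at \<open>x0\<close> nor value and slope at the points of \<open>S\<close>.\<close>

definition node_poly :: "real \<Rightarrow> real set \<Rightarrow> real poly" where
  "node_poly x0 S = [:- x0, 1:] * (\<Prod>y\<in>S. [:- y, 1:])\<^sup>2"

lemma poly_node_poly:
  "poly (node_poly x0 S) x = (x - x0) * (\<Prod>y\<in>S. x - y)\<^sup>2"
  by (simp add: node_poly_def poly_prod algebra_simps)

lemma node_poly_double_zero:
  assumes "finite S" and "x \<in> S"
  shows "poly (node_poly x0 S) x = 0" and "poly (pderiv (node_poly x0 S)) x = 0"
proof -
  have z: "poly (\<Prod>y\<in>S. [:- y, 1:]) x = 0"
    using assms by (auto simp: poly_prod intro!: prod_zero)
  then show "poly (node_poly x0 S) x = 0" "poly (pderiv (node_poly x0 S)) x = 0"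
    unfolding node_poly_def pderiv_mult power2_eq_square by simp_all
qed

lemma degree_node_poly: "degree (node_poly x0 S) = Suc (2 * card S)"
  and lead_coeff_node_poly: "lead_coeff (node_poly x0 S) = 1"
proof -
  have 1: "lead_coeff (\<Prod>y\<in>S. [:- y, 1::real:]) = 1" by (simp add: lead_coeff_prod)
  have 2: "degree (\<Prod>y\<in>S. [:- y, 1::real:]) = card S"
    by (cases "finite S") (auto simp: degree_prod_sum_eq)
  from 1 have "(\<Prod>y\<in>S. [:- y, 1::real:]) \<noteq> 0" by force
  then show "degree (node_poly x0 S) = Suc (2 * card S)"
    unfolding node_poly_def by (subst degree_mult_eq) (auto simp: degree_power_eq 2)
  show "lead_coeff (node_poly x0 S) = 1"
    unfolding node_poly_def lead_coeff_mult lead_coeff_power 1 by simp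
qed

text \<open>Newton's scheme: each new node costs two degrees, paid for by a linear factor times the
  node polynomial of the earlier nodes. Its two coefficients match value and slope at the new
  node.\<close>

lemma Hermite_interpolation_exists:
  fixes v :: "real \<Rightarrow> real"
  assumes "finite S" and "x0 \<notin> S"
  shows "\<exists>q. degree q \<le> 2 * card S \<and> poly q x0 = v x0 \<and>
           (\<forall>x\<in>S. poly q x = v x \<and> poly (pderiv q) x = 0)"
  using assms
proof (induction S rule: finite_induct)
  case empty
  show ?case by (intro exI[of _ "[:v x0:]"]) auto
next
  case (insert x S)
  then obtain q where q: "degree q \<le> 2 * card S" "poly q x0 = v x0"
    "\<And>y. y \<in> S \<Longrightarrow> poly q y = v y \<and> poly (pderiv q) y = 0" by auto
  define P where "P = node_poly x0 S"
  have Px: "poly P x \<noteq> 0" using insert by (auto simp: P_def poly_node_poly)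
  \<comment> \<open>The linear factor in \<open>g\<close> is \<alpha> + \<beta> (X - x). Its value
    \<alpha> at \<open>x\<close> corrects the value of \<open>q\<close> there; then its slope
    \<beta> cancels the derivative.\<close>
  define \<alpha> where "\<alpha> = (v x - poly q x) / poly P x"
  define \<beta> where "\<beta> = - (poly (pderiv q) x + \<alpha> * poly (pderiv P) x) / poly P x"
  define g where "g = q + [:\<alpha> - \<beta> * x, \<beta>:] * P"
  have "degree ([:\<alpha> - \<beta> * x, \<beta>:] * P) \<le> 1 + Suc (2 * card S)"
    by (rule order_trans[OF degree_mult_le]) (simp add: P_def degree_node_poly)
  then have "degree g \<le> 2 * card (insert x S)"
    unfolding g_def using q(1) insert.hyps by (intro degree_add_le) auto
  moreover have "poly g x0 = v x0" by (simp add: g_def q P_def poly_node_poly)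
  moreover have "poly g y = v y \<and> poly (pderiv g) y = 0" if "y \<in> S" for y
    using q(3)[OF that] node_poly_double_zero[OF insert.hyps(1) that, of x0]
    by (simp add: g_def P_def pderiv_mult pderiv_add del: mult_pCons_left)
  moreover have "poly g x = v x"
  proof -
    have "poly g x = poly q x + \<alpha> * poly P x" by (simp add: g_def algebra_simps)
    then show ?thesis using Px by (simp add: \<alpha>_def)
  qed
  moreover have "poly (pderiv g) x = 0"
  proof -
    have "poly (pderiv g) x = poly (pderiv q) x + \<alpha> * poly (pderiv P) x + \<beta> * poly P x"
      by (simp add: g_def pderiv_mult pderiv_add pderiv_pCons pderiv_smult
          algebra_simps)
    then show ?thesis using Px by (simp add: \<beta>_def)
  qed
  ultimately show ?case by (intro exI[of _ g]) auto
qed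

text \<open>
  The interpolant \<open>q\<close> of the step is flat at every node except \<open>Max A\<close>.  Its excess over the step
  at \<open>t\<close> is read off from \<open>f = q - \<gamma> P\<close>, where \<open>\<gamma>\<close> makes \<open>f\<close> agree with the step at \<open>t\<close>, too:
  the leading coefficient \<open>- \<gamma>\<close> of \<open>f\<close> has a known sign.
\<close>

lemma step_majorant:
  fixes A B :: "real set"
  assumes fin: "finite A" "finite B" and ne: "A \<noteq> {}" "B \<noteq> {}"
    and sep: "\<And>x y. x \<in> A \<Longrightarrow> y \<in> B \<Longrightarrow> x < y"
  obtains q where "degree q \<le> 2 * card (A \<union> B) - 2"
    and "\<And>x. x \<in> A \<Longrightarrow> poly q x = 1" and "\<And>x. x \<in> B \<Longrightarrow> poly q x = 0"
    and "\<And>t. t \<notin> A \<union> B \<Longrightarrow> poly q t > (if t \<le> Max A then 1 else 0)"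
proof -
  define x0 where "x0 = Max A"
  have x0: "x0 \<in> A" "\<And>x. x \<in> A \<Longrightarrow> x \<le> x0" using fin ne by (auto simp: x0_def)
  have AB: "A \<inter> B = {}" using sep by fastforce
  \<comment> \<open>The last point of \<open>A\<close> is the one node without a slope condition,
    which keeps the degree at \<open>2 * card D\<close>.\<close>
  define D where "D = A \<union> B - {x0}"
  have D: "finite D" "x0 \<notin> D" "insert x0 D = A \<union> B" using fin x0 by (auto simp: D_def)
  have cAB: "card A > 0" "card B > 0" using fin ne by (auto simp: card_gt_0_iff)
  have cU: "card (A \<union> B) = card A + card B" using card_Un_disjoint fin AB by blast
  have cD: "card D = card A + card B - 1"
    using D by (metis cU card_insert_disjoint diff_Suc_1)
  have DB: "D \<inter> B = B" using x0 AB by (auto simp: D_def)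
  obtain q where q: "degree q \<le> 2 * card D"
    "poly q x0 = (if x0 \<in> A then 1 else 0)"
    "\<And>x. x \<in> D \<Longrightarrow> poly q x = (if x \<in> A then 1 else 0) \<and> poly (pderiv q) x = 0"
    using Hermite_interpolation_exists[OF D(1,2), of "\<lambda>x. if x \<in> A then 1 else 0"] by auto
  have qA: "poly q x = 1" if "x \<in> A" for x using q(2) q(3)[of x] that D(3) x0 by (cases "x = x0") auto
  have qB: "poly q x = 0" if "x \<in> B" for x proof -
    have "x \<in> D" "x \<notin> A" using that DB AB by auto
    then show ?thesis using q(3)[of x] by simp
  qed
  define P where "P = node_poly x0 D"
  have Pz: "poly P x = 0" if "x \<in> A \<union> B" for x
  proof (cases "x = x0")
    case False
    then have "x \<in> D" using that D(3) by auto
    then show ?thesis using node_poly_double_zero(1)[OF D(1)] by (simp add: P_def)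
  qed (simp add: P_def poly_node_poly)
  \<comment> \<open>The squared factor is positive off the nodes, so there \<open>P\<close> has the
    sign of \<open>t - x0\<close>.\<close>
  have Pnz: "(\<Prod>y\<in>D. t - y)\<^sup>2 > 0" if "t \<notin> A \<union> B" for t using that D by auto
  define f where "f = (\<lambda>\<gamma>. q - smult \<gamma> P)"
  have fz: "poly (f \<gamma>) x = poly q x" if "x \<in> A \<union> B" for x \<gamma> using Pz[OF that] by (simp add: f_def)
  have fD: "poly (pderiv (f \<gamma>)) x = 0" if "x \<in> D" for x \<gamma>
    using q(3)[OF that] node_poly_double_zero(2)[OF D(1) that]
    by (simp add: f_def P_def pderiv_diff pderiv_smult)
  have degf: "degree (f \<gamma>) \<le> Suc (2 * card D)" for \<gamma>
    unfolding f_def using q(1)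
    by (intro degree_diff_le order_trans[OF degree_smult_le]) (auto simp: P_def degree_node_poly)
  have lcf: "coeff (f \<gamma>) (Suc (2 * card D)) = - \<gamma>" for \<gamma>
    using lead_coeff_node_poly[of x0 D] q(1)
    by (simp add: f_def P_def degree_node_poly coeff_eq_0)
  have upper: "poly q t > 0" if t: "t \<notin> A \<union> B" "t > x0" for t
  proof -
    define \<gamma> where "\<gamma> = poly q t / poly P t"
    have Pt: "poly P t > 0" using t Pnz[OF t(1)] by (simp add: P_def poly_node_poly)
    then have ft: "poly (f \<gamma>) t = 0" by (simp add: f_def \<gamma>_def)
    have DB': "D \<inter> insert t B = B" using DB t D(3) by auto
    \<comment> \<open>Since \<open>f \<gamma>\<close> vanishes at \<open>t\<close>, this point joins
      \<open>B\<close>. As \<open>t\<close> is not in \<open>D\<close>, the exponent is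
      \<open>2 * card B + 1\<close>, odd, and the coefficient is \<open>- \<gamma>\<close>; hence
      \<gamma> is positive.\<close>
    have "(- 1) ^ (card (D \<inter> insert t B) + card (insert t B)) * coeff (f \<gamma>) (Suc (2 * card D)) > 0"
    proof (rule step_poly_lead_coeff_sign[of A])
      show "x < y" if "x \<in> A" "y \<in> insert t B" for x y
        using that sep x0 t by force
      show "D \<subseteq> A \<union> insert t B" using D by auto
      show "2 * card D = card A + card (insert t B) - 2 + card D"
        using cD cAB t fin by simp
    qed (use fin ne t fz fD qA qB ft degf in auto)
    then have "\<gamma> > 0" using t fin by (simp add: DB' lcf)
    then show ?thesis using Pt by (simp add: \<gamma>_def zero_less_divide_iff)
  qed
  have lower: "poly q t > 1" if t: "t \<notin> A \<union> B" "t < x0" for t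
  proof -
    define \<gamma> where "\<gamma> = (poly q t - 1) / poly P t"
    have Pt: "poly P t < 0" using t Pnz[OF t(1)] by (simp add: P_def poly_node_poly mult_neg_pos)
    then have ft: "poly (f \<gamma>) t = 1" by (simp add: f_def \<gamma>_def)
    \<comment> \<open>Here \<open>f \<gamma>\<close> equals 1 at \<open>t\<close>, so the point
      joins \<open>A\<close>. The exponent \<open>2 * card B\<close> is even, hence \<gamma> is
      negative, as is \<open>P\<close> at \<open>t\<close>.\<close>
    have "(- 1) ^ (card (D \<inter> B) + card B) * coeff (f \<gamma>) (Suc (2 * card D)) > 0"
    proof (rule step_poly_lead_coeff_sign[of "insert t A"])
      show "x < y" if "x \<in> insert t A" "y \<in> B" for x y
        using that sep[of x0 y] sep[of x y] x0 t by auto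
      show "D \<subseteq> insert t A \<union> B" using D by auto
      show "2 * card D = card (insert t A) + card B - 2 + card D"
        using cD cAB t fin by simp
    qed (use fin ne t fz fD qA qB ft degf in auto)
    then have "\<gamma> < 0" using t fin by (simp add: DB lcf)
    then show ?thesis using Pt by (simp add: \<gamma>_def divide_less_0_iff)
  qed
  show thesis
  proof (rule that[of q])
    show "degree q \<le> 2 * card (A \<union> B) - 2" using q(1) cD cU by simp
    show "poly q t > (if t \<le> Max A then 1 else 0)" if "t \<notin> A \<union> B" for t
      using upper lower that x0(1) unfolding x0_def[symmetric]
      by (cases t x0 rule: linorder_cases) auto
  qed (use qA qB in auto)
qed

section \<open>Separation inequalities for polynomial quadrature\<close>

text \<open>Apply the quadrature to the polynomial above the step: on the \<open>J\<close> side it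
  overestimates the partial sum of the \<open>u j\<close>, on the \<open>I\<close> side it
  reproduces the partial sum of the \<open>v i\<close>. The node \<open>y l\<close> supplies a point
  after the jump.\<close>

lemma Chebyshev_Markov_Stieltjes:
  fixes x :: "'j \<Rightarrow> real" and y :: "'i \<Rightarrow> real"
  assumes fin: "finite J" "finite I" and card: "card I < card J"
    and inj: "inj_on x J" "inj_on y I" and u: "\<And>j. j \<in> J \<Longrightarrow> u j > (0::real)"
    and quad: "\<And>q. degree q \<le> 2 * card I - 2 \<Longrightarrow>
      (\<Sum>j\<in>J. u j * poly q (x j)) = (\<Sum>i\<in>I. v i * poly q (y i))"
    and k: "k \<in> I" "l \<in> I" "y k < y l"
  shows "(\<Sum>j | j \<in> J \<and> x j \<le> y k. u j) < (\<Sum>i | i \<in> I \<and> y i \<le> y k. v i)"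
proof -
  define A B where "A = {t \<in> y ` I. t \<le> y k}" and "B = {t \<in> y ` I. y k < t}"
  have AB: "A \<union> B = y ` I" by (auto simp: A_def B_def)
  have MaxA: "Max A = y k" using fin k by (intro Max_eqI) (auto simp: A_def)
  obtain q where q: "degree q \<le> 2 * card (A \<union> B) - 2"
    "\<And>x. x \<in> A \<Longrightarrow> poly q x = 1" "\<And>x. x \<in> B \<Longrightarrow> poly q x = 0"
    "\<And>t. t \<notin> A \<union> B \<Longrightarrow> poly q t > (if t \<le> Max A then 1 else 0)"
  proof (rule step_majorant[of A B])
    show "finite A" "finite B" using fin by (auto simp: A_def B_def)
    show "A \<noteq> {}" "B \<noteq> {}" using k by (auto simp: A_def B_def)
  qed (auto simp: A_def B_def)
  have ge: "poly q t \<ge> (if t \<le> y k then 1 else 0)" for t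
  proof (cases "t \<in> A \<union> B")
    case True
    then show ?thesis using q(2,3)[of t] by (auto simp: A_def B_def)
  next
    case False
    then show ?thesis using q(4)[of t] MaxA by auto
  qed
  \<comment> \<open>By counting, some \<open>x j\<close> is no node; there the polynomial exceeds
    the step, and \<open>u j > 0\<close> makes the inequality strict.\<close>
  have "\<not> x ` J \<subseteq> y ` I"
  proof
    assume "x ` J \<subseteq> y ` I"
    then have "card (x ` J) \<le> card (y ` I)" using fin by (intro card_mono) auto
    then show False using card inj by (simp add: card_image)
  qed
  then obtain j where j: "j \<in> J" "x j \<notin> A \<union> B" unfolding AB by auto
  have "(\<Sum>j | j \<in> J \<and> x j \<le> y k. u j) = (\<Sum>j\<in>J. u j * (if x j \<le> y k then 1 else 0))"
    using fin by (simp add: if_distrib sum.inter_filter cong: if_cong)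
  also have "\<dots> < (\<Sum>j\<in>J. u j * poly q (x j))"
  proof (rule sum_strict_mono_ex1)
    show "\<forall>i\<in>J. u i * (if x i \<le> y k then 1 else 0) \<le> u i * poly q (x i)"
      using ge u by (intro ballI mult_left_mono) (auto simp: less_imp_le)
    have "u j * (if x j \<le> y k then 1 else 0) < u j * poly q (x j)"
      using q(4)[OF j(2)] u[OF j(1)] MaxA by (intro mult_strict_left_mono) auto
    with j show "\<exists>i\<in>J. u i * (if x i \<le> y k then 1 else 0) < u i * poly q (x i)" by blast
  qed (use fin in auto)
  also have "\<dots> = (\<Sum>i\<in>I. v i * poly q (y i))"
    using q(1) inj by (intro quad) (simp add: AB card_image)
  also have "\<dots> = (\<Sum>i\<in>I. v i * (if y i \<le> y k then 1 else 0))"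
    using q(2,3) by (intro sum.cong) (auto simp: A_def B_def)
  also have "\<dots> = (\<Sum>i | i \<in> I \<and> y i \<le> y k. v i)"
    using fin by (simp add: if_distrib sum.inter_filter cong: if_cong)
  finally show ?thesis .
qed

text \<open>The reflection \<open>t \<mapsto> - t\<close> turns the upper tails into lower ones.\<close>

lemma Chebyshev_Markov_Stieltjes_less:
  fixes x :: "'j \<Rightarrow> real" and y :: "'i \<Rightarrow> real"
  assumes fin: "finite J" "finite I" and card: "card I < card J"
    and inj: "inj_on x J" "inj_on y I" and u: "\<And>j. j \<in> J \<Longrightarrow> u j > (0::real)"
    and quad: "\<And>q. degree q \<le> 2 * card I - 2 \<Longrightarrow>
      (\<Sum>j\<in>J. u j * poly q (x j)) = (\<Sum>i\<in>I. v i * poly q (y i))"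
    and k: "k \<in> I" "l \<in> I" "y l < y k"
  shows "(\<Sum>i | i \<in> I \<and> y i < y k. v i) < (\<Sum>j | j \<in> J \<and> x j < y k. u j)"
proof -
  have "(\<Sum>j | j \<in> J \<and> - x j \<le> - y k. u j) < (\<Sum>i | i \<in> I \<and> - y i \<le> - y k. v i)"
  proof (rule Chebyshev_Markov_Stieltjes[OF fin card _ _ u _ k(1,2)])
    show "(\<Sum>j\<in>J. u j * poly q (- x j)) = (\<Sum>i\<in>I. v i * poly q (- y i))"
      if "degree q \<le> 2 * card I - 2" for q
    proof -
      have "degree (pcompose q [:0, - 1:]) \<le> 2 * card I - 2"
        using that by (simp add: degree_pcompose)
      from quad[OF this] show ?thesis by (simp add: poly_pcompose)
    qed
  qed (use inj k in \<open>auto simp: inj_on_def\<close>)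
  moreover have "(\<Sum>j\<in>J. u j) = (\<Sum>j | j \<in> J \<and> x j < y k. u j) + (\<Sum>j | j \<in> J \<and> - x j \<le> - y k. u j)"
    using fin by (subst sum.union_disjoint[symmetric]) (auto intro!: sum.cong)
  moreover have "(\<Sum>i\<in>I. v i) = (\<Sum>i | i \<in> I \<and> y i < y k. v i) + (\<Sum>i | i \<in> I \<and> - y i \<le> - y k. v i)"
    using fin by (subst sum.union_disjoint[symmetric]) (auto intro!: sum.cong)
  \<comment> \<open>Exactness for the constant 1 equates the total masses, so the tail inequality
    passes to the complements.\<close>
  moreover have "(\<Sum>j\<in>J. u j) = (\<Sum>i\<in>I. v i)" using quad[of 1] by simp
  ultimately show ?thesis by linarith
qed

section \<open>Moving the pole to infinity\<close>

text \<open>The map increases on each side of \<open>s\<close> and is negative exactly to the right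
  of \<open>s\<close>. The line is thus cut at \<open>s\<close> and the right part is put before the
  left part.\<close>

lemma inverse_pole_le_iff:
  fixes x y s :: real
  assumes "x \<noteq> s" and "y \<noteq> s"
  shows "1 / (s - x) \<le> 1 / (s - y) \<longleftrightarrow> (if y > s then s < x \<and> x \<le> y else x \<le> y \<or> s < x)"
  using assms by (auto simp: divide_simps split: if_splits)

lemma inverse_pole_less_iff:
  fixes x y s :: real
  assumes "x \<noteq> s" and "y \<noteq> s"
  shows "1 / (s - x) < 1 / (s - y) \<longleftrightarrow> (if y > s then s < x \<and> x < y else x < y \<or> s < x)"
  using inverse_pole_le_iff[OF assms] inverse_pole_le_iff[OF assms(2,1)] assms
  by (auto simp: not_le[symmetric])

lemma rational_quadrature_substitution:
  fixes lam \<theta> :: "nat \<Rightarrow> real" and u v :: "nat \<Rightarrow> real" and q :: "real poly"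
  assumes quad: "\<And>p :: complex poly. degree p \<le> N \<Longrightarrow>
      (\<Sum>j\<in>J. of_real (u j) * (poly p (of_real (lam j)) / of_real (lam j - s) ^ N)) =
      (\<Sum>i\<in>I. of_real (v i) * (poly p (of_real (\<theta> i)) / of_real (\<theta> i - s) ^ N))"
    and s: "\<And>j. j \<in> J \<Longrightarrow> lam j \<noteq> s" "\<And>i. i \<in> I \<Longrightarrow> \<theta> i \<noteq> s"
    and deg: "degree q \<le> N"
  shows "(\<Sum>j\<in>J. u j * poly q (1 / (s - lam j))) = (\<Sum>i\<in>I. v i * poly q (1 / (s - \<theta> i)))"
proof -
  \<comment> \<open>With t = 1/(s - x) = -1/(x - s), multiplying q(t) by (x - s)^N turns t^i into
    (-1)^i (x - s)^(N - i).\<close>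
  define p :: "complex poly" where
    "p = (\<Sum>i\<le>N. smult (of_real (coeff q i * (- 1) ^ i)) ([:- of_real s, 1:] ^ (N - i)))"
  have "degree p \<le> N"
    unfolding p_def
  proof (rule degree_sum_le)
    fix i assume "i \<in> {..N}"
    have "degree ([:- complex_of_real s, 1:] ^ (N - i)) \<le> N"
      by (rule order_trans[OF degree_power_le]) simp
    then show "degree (smult (of_real (coeff q i * (- 1) ^ i)) ([:- complex_of_real s, 1:] ^ (N - i))) \<le> N"
      using degree_smult_le order_trans by blast
  qed simp
  have r: "poly p (of_real x) / of_real (x - s) ^ N = of_real (poly q (1 / (s - x)))"
    if x: "x \<noteq> s" for x
  proof -
    have "poly p (of_real x) = of_real (\<Sum>i\<le>N. coeff q i * (- 1) ^ i * (x - s) ^ (N - i))"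
      by (simp add: p_def poly_sum)
    then have "poly p (of_real x) / of_real (x - s) ^ N =
        complex_of_real ((\<Sum>i\<le>N. coeff q i * (- 1) ^ i * (x - s) ^ (N - i)) / (x - s) ^ N)"
      by simp
    also have "(\<Sum>i\<le>N. coeff q i * (- 1) ^ i * (x - s) ^ (N - i)) / (x - s) ^ N =
        (\<Sum>i\<le>N. coeff q i * (1 / (s - x)) ^ i)"
      unfolding sum_divide_distrib
    proof (rule sum.cong)
      fix i assume "i \<in> {..N}"
      then have "(x - s) ^ (N - i) / (x - s) ^ N = (1 / (x - s)) ^ i"
        using x by (simp add: power_diff power_divide)
      moreover have "(- 1) ^ i * (1 / (x - s)) ^ i = (1 / (s - x)) ^ i"
      proof -
        have "- 1 * (1 / (x - s)) = 1 / (s - x)" using x by (simp add: divide_simps)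
        then show ?thesis by (metis power_mult_distrib)
      qed
      ultimately show "coeff q i * (- 1) ^ i * (x - s) ^ (N - i) / (x - s) ^ N =
          coeff q i * (1 / (s - x)) ^ i"
        by (metis mult.assoc times_divide_eq_right)
    qed simp
    also have "\<dots> = poly q (1 / (s - x))"
      unfolding poly_altdef using deg
      by (intro sum.mono_neutral_right) (auto simp: coeff_eq_0)
    finally show ?thesis .
  qed
  \<comment> \<open>The hypothesis is an identity between complex numbers; the real one is embedded
    and recovered by injectivity of \<open>of_real\<close>.\<close>
  have "complex_of_real (\<Sum>j\<in>J. u j * poly q (1 / (s - lam j))) =
      (\<Sum>j\<in>J. of_real (u j) * (poly p (of_real (lam j)) / of_real (lam j - s) ^ N))"
    unfolding of_real_sum of_real_mult by (intro sum.cong refl) (simp only: r[OF s(1)])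
  also have "\<dots> = (\<Sum>i\<in>I. of_real (v i) * (poly p (of_real (\<theta> i)) / of_real (\<theta> i - s) ^ N))"
    by (rule quad[OF \<open>degree p \<le> N\<close>])
  also have "\<dots> = complex_of_real (\<Sum>i\<in>I. v i * poly q (1 / (s - \<theta> i)))"
    unfolding of_real_sum of_real_mult by (intro sum.cong refl) (simp only: r[OF s(2)])
  finally show ?thesis by (simp only: of_real_eq_iff)
qed

section \<open>Index sets and the sets \<open>R_set\<close> as initial segments of the cyclic
  order\<close>

text \<open>Either all nodes lie on one side of the pole and keep their order under the
  substitution, or \<open>l\<close> is the last node before \<open>s\<close> and the cyclic order
  starts at \<open>l + 1\<close>.\<close>

lemma k_last_k_first_cases:
  assumes "1 \<le> m" and mono: "strict_mono_on {1..m} \<theta>" and ne: "\<forall>j\<in>{1..m}. \<theta> j \<noteq> s"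
  obtains
    (outside) "k_first m s \<theta> = 1" "k_last m s \<theta> = m"
      "(\<forall>i\<in>{1..m}. \<theta> i < s) \<or> (\<forall>i\<in>{1..m}. s < \<theta> i)"
  | (between) l where "k_first m s \<theta> = l + 1" "k_last m s \<theta> = l" "1 \<le> l" "l < m"
      "\<And>i. i \<in> {1..m} \<Longrightarrow> (\<theta> i < s \<longleftrightarrow> i \<le> l)"
proof (cases "\<theta> 1 < s \<and> s < \<theta> m")
  case False
  have le: "\<theta> 1 \<le> \<theta> i" "\<theta> i \<le> \<theta> m" if "i \<in> {1..m}" for i
    using that strict_mono_on_leD[OF mono, of 1 i] strict_mono_on_leD[OF mono, of i m] by auto
  have "(\<forall>i\<in>{1..m}. \<theta> i < s) \<or> (\<forall>i\<in>{1..m}. s < \<theta> i)"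
  proof (cases "\<theta> 1 < s")
    case True
    then have "\<theta> m < s" using False ne assms(1) by force
    then show ?thesis using le by fastforce
  next
    case False
    then have "s < \<theta> 1" using ne assms(1) by force
    then show ?thesis using le by fastforce
  qed
  then show ?thesis using False by (intro outside) (auto simp: k_first_def k_last_def)
next
  case True
  define l where "l = Max {i \<in> {1..m}. \<theta> i < s}"
  have ne': "{i \<in> {1..m}. \<theta> i < s} \<noteq> {}" using True assms(1) by force
  have "l \<in> {i \<in> {1..m}. \<theta> i < s}" unfolding l_def by (rule Max_in) (use ne' in auto)
  then have l: "l \<in> {1..m}" "\<theta> l < s" by auto
  have lmax: "i \<le> l" if "i \<in> {1..m}" "\<theta> i < s" for i
    unfolding l_def using that by (intro Max_ge) auto
  have "l \<noteq> m" using True l by auto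
  then have lm: "l < m" using l by auto
  have iff: "\<theta> i < s \<longleftrightarrow> i \<le> l" if "i \<in> {1..m}" for i
    using lmax[OF that] strict_mono_on_leD[OF mono that l(1)] l(2) by fastforce
  have gt: "s < \<theta> (l + 1)"
    using iff[of "l + 1"] bspec[OF ne, of "l + 1"] lm by auto
  have unique: "k = l" if k: "k \<in> {1..<m}" "\<theta> k < s" "s < \<theta> (k + 1)" for k
    using iff[of k] iff[of "k + 1"] k by auto
  have "(THE k. k \<in> {1..<m} \<and> \<theta> k < s \<and> s < \<theta> (k + 1)) = l"
  proof (rule the_equality)
    show "l \<in> {1..<m} \<and> \<theta> l < s \<and> s < \<theta> (l + 1)" using l lm gt by simp
  qed (use unique in blast)
  then have "k_last m s \<theta> = l" using True by (simp only: k_last_def if_True simp_thms)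
  moreover from this have "k_first m s \<theta> = l + 1" using True by (simp only: k_first_def if_True simp_thms)
  ultimately show ?thesis using l(1) lm iff between[of l] by simp
qed

text \<open>Inside (a,b), passing to the interior removes just the endpoint
  \<open>\<theta> i\<close>, which makes the inequality strict.\<close>

lemma mem_interior_R_set_iff:
  assumes "x \<noteq> s" and y: "\<theta> i \<noteq> s" "\<theta> i \<in> einterval a b" and x: "x \<in> einterval a b"
    and i: "i = (if k = m + 1 then 1 else k)"
  shows "x \<in> interior (R_set a b m s \<theta> k) \<longleftrightarrow> 1 / (s - x) < 1 / (s - \<theta> i)"
proof (cases "s < \<theta> i")
  case True
  then have "R_set a b m s \<theta> k = {s<..\<theta> i}" using i by (simp add: R_set_def Let_def)
  then show ?thesis using True assms by (simp add: inverse_pole_less_iff)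
next
  case False
  then have lt: "\<theta> i < s" using y by simp
  have R: "R_set a b m s \<theta> k = {x. a < ereal x \<and> x \<le> \<theta> i} \<union> einterval (ereal s) b"
    using False i by (simp add: R_set_def Let_def)
  let ?O = "einterval a (ereal (\<theta> i)) \<union> einterval (ereal s) b"
  have "open ?O" by (intro open_Un open_einterval)
  moreover have "?O \<subseteq> R_set a b m s \<theta> k" unfolding R by (auto simp: einterval_def)
  ultimately have "?O \<subseteq> interior (R_set a b m s \<theta> k)" by (rule interior_maximal[rotated])
  moreover have "\<theta> i \<notin> interior (R_set a b m s \<theta> k)"
  proof
    assume "\<theta> i \<in> interior (R_set a b m s \<theta> k)"
    then obtain e where e: "e > 0" "ball (\<theta> i) e \<subseteq> R_set a b m s \<theta> k"
      by (auto simp: mem_interior)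
    \<comment> \<open>A point within \<open>e\<close> to the right of \<open>\<theta> i\<close> but
      before \<open>s\<close> falls into the part of the line that the wrapped set omits.\<close>
    define z where "z = \<theta> i + min (e / 2) ((s - \<theta> i) / 2)"
    have "z > \<theta> i" "z < s" "z - \<theta> i < e" using e lt by (auto simp: z_def min_def field_simps)
    then have "z \<in> ball (\<theta> i) e" "z \<notin> R_set a b m s \<theta> k"
      by (auto simp: R dist_real_def einterval_def)
    with e show False by auto
  qed
  ultimately have "x \<in> interior (R_set a b m s \<theta> k) \<longleftrightarrow> x \<in> ?O"
    using interior_subset[of "R_set a b m s \<theta> k"] unfolding R by (force simp: einterval_def)
  then show ?thesis
    using x False lt assms by (auto simp: inverse_pole_less_iff einterval_def)
qed

lemma mem_R_set_iff:
  assumes "x \<noteq> s" and "\<theta> k \<noteq> s" and "x \<in> einterval a b" and "k \<le> m"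
  shows "x \<in> R_set a b m s \<theta> k \<longleftrightarrow> 1 / (s - x) \<le> 1 / (s - \<theta> k)"
  using assms by (auto simp: R_set_def Let_def inverse_pole_le_iff einterval_def)

text \<open>The index \<open>k'\<close> is the cyclic successor of \<open>k\<close>, and
  \<open>k\<close> is not last in the order that starts at the pole. So nothing lies strictly
  between the two images, and both descriptions give the same initial segment.\<close>

lemma I_set_eq:
  assumes m: "1 \<le> m" and mono: "strict_mono_on {1..m} \<theta>" and ne: "\<forall>j\<in>{1..m}. \<theta> j \<noteq> s"
    and k: "k \<in> {1..m} - {k_last m s \<theta>}" and k': "k' = (if k = m then 1 else k + 1)"
  shows "I_set m s \<theta> k = {i \<in> {1..m}. 1 / (s - \<theta> i) \<le> 1 / (s - \<theta> k)}"
    and "I_set m s \<theta> k = {i \<in> {1..m}. 1 / (s - \<theta> i) < 1 / (s - \<theta> k')}"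
proof -
  have less: "\<theta> i < \<theta> j \<longleftrightarrow> i < j" and le: "\<theta> i \<le> \<theta> j \<longleftrightarrow> i \<le> j"
    if "i \<in> {1..m}" "j \<in> {1..m}" for i j
    using strict_mono_on_less[OF mono that] strict_mono_on_less_eq[OF mono that] by auto
  have k'm: "k' \<in> {1..m}" using k k' m by auto
  have "I_set m s \<theta> k = {i \<in> {1..m}. 1 / (s - \<theta> i) \<le> 1 / (s - \<theta> k)} \<and>
        I_set m s \<theta> k = {i \<in> {1..m}. 1 / (s - \<theta> i) < 1 / (s - \<theta> k')}"
    using m mono ne
  proof (cases rule: k_last_k_first_cases)
    case outside
    have km: "k < m" and k1: "k' = k + 1" using k outside k' by auto
    have "I_set m s \<theta> k = {1..k}" using outside k by (auto simp: I_set_def)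
    moreover have "1 / (s - \<theta> i) \<le> 1 / (s - \<theta> j) \<longleftrightarrow> i \<le> j"
      "1 / (s - \<theta> i) < 1 / (s - \<theta> j) \<longleftrightarrow> i < j" if ij: "i \<in> {1..m}" "j \<in> {1..m}" for i j
    proof -
      have "s < \<theta> i \<longleftrightarrow> s < \<theta> j" using outside(3) ij by (meson less_asym)
      then show "1 / (s - \<theta> i) \<le> 1 / (s - \<theta> j) \<longleftrightarrow> i \<le> j" "1 / (s - \<theta> i) < 1 / (s - \<theta> j) \<longleftrightarrow> i < j"
        using ij less[OF ij] le[OF ij] ne by (auto simp: inverse_pole_le_iff inverse_pole_less_iff)
    qed
    ultimately show ?thesis using k k'm km k1 by auto
  next
    case (between l)
    have gt: "s < \<theta> i \<longleftrightarrow> l < i" if "i \<in> {1..m}" for i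
    proof -
      have "\<theta> i \<noteq> s" using ne that by blast
      then show ?thesis using between(5)[OF that] by linarith
    qed
    have *: "1 / (s - \<theta> i) \<le> 1 / (s - \<theta> j) \<longleftrightarrow> (if l < j then l < i \<and> i \<le> j else i \<le> j \<or> l < i)"
      "1 / (s - \<theta> i) < 1 / (s - \<theta> j) \<longleftrightarrow> (if l < j then l < i \<and> i < j else i < j \<or> l < i)"
      if ij: "i \<in> {1..m}" "j \<in> {1..m}" for i j
      using ij less[OF ij] le[OF ij] ne gt
      by (auto simp: inverse_pole_le_iff inverse_pole_less_iff)
    define I where "I = (if l < k then {l+1..k} else {1..k} \<union> {l+1..m})"
    have "I_set m s \<theta> k = I" using between by (auto simp: I_set_def I_def)
    moreover have "{i \<in> {1..m}. 1 / (s - \<theta> i) \<le> 1 / (s - \<theta> k)} =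
        {i \<in> {1..m}. if l < k then l < i \<and> i \<le> k else i \<le> k \<or> l < i}"
      using *(1)[of _ k] k by blast
    moreover have "\<dots> = I" using k by (auto simp: I_def)
    moreover have "{i \<in> {1..m}. 1 / (s - \<theta> i) < 1 / (s - \<theta> k')} =
        {i \<in> {1..m}. if l < k' then l < i \<and> i < k' else i < k' \<or> l < i}"
      using *(2)[of _ k'] k'm by blast
    \<comment> \<open>For \<open>k = m\<close> the successor 1 is at most \<open>l\<close>, and just
      the indices above \<open>l\<close> remain. Otherwise \<open>k \<noteq> l\<close> keeps
      \<open>k\<close> and \<open>k + 1\<close> on the same side of the pole.\<close>
    moreover have "\<dots> = I"
    proof (cases "k = m")
      case True
      then show ?thesis using between(3,4) k' by (auto simp: I_def)
    next
      case False
      then show ?thesis using k k' between(2) by (auto simp: I_def)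
    qed
    ultimately show ?thesis by (simp only: simp_thms)
  qed
  then show "I_set m s \<theta> k = {i \<in> {1..m}. 1 / (s - \<theta> i) \<le> 1 / (s - \<theta> k)}"
    "I_set m s \<theta> k = {i \<in> {1..m}. 1 / (s - \<theta> i) < 1 / (s - \<theta> k')}" by blast+
qed

theorem theorem4p11:
  fixes m n :: nat
    and a b :: ereal
    and s :: real
    and lam \<theta> :: "nat \<Rightarrow> real"
    and w c :: "nat \<Rightarrow> complex"
  assumes "1 \<le> m" and "m < n"
    and "strict_mono_on {1..n} lam"
    and "\<forall>j\<in>{1..n}. lam j \<in> einterval a b"
    and "\<forall>j\<in>{1..n}. w j \<noteq> 0"
    and "\<forall>j\<in>{1..n}. s \<noteq> lam j"
    and "strict_mono_on {1..m} \<theta>"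
    and "\<forall>j\<in>{1..m}. \<theta> j \<in> einterval a b"
    and "\<forall>j\<in>{1..m}. \<theta> j \<noteq> s"
    and "\<forall>p :: complex poly. degree p \<le> 2 * m - 2 \<longrightarrow>
           (let r = (\<lambda>x::real. poly p (of_real x) / of_real (x - s) ^ (2 * m - 2)) in
            (\<Sum>j=1..n. of_real ((cmod (w j))\<^sup>2) * r (lam j)) =
            (\<Sum>j=1..m. of_real ((cmod (c j))\<^sup>2) * r (\<theta> j)))"
  shows "\<forall>k\<in>{1..m} - {k_last m s \<theta>}.
           mu n lam w (R_set a b m s \<theta> k) < (\<Sum>j\<in>I_set m s \<theta> k. (cmod (c j))\<^sup>2) \<and>
           (\<Sum>j\<in>I_set m s \<theta> k. (cmod (c j))\<^sup>2) < mu n lam w (interior (R_set a b m s \<theta> (k + 1)))"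
proof (intro ballI)
  fix k assume k: "k \<in> {1..m} - {k_last m s \<theta>}"
  define T where "T x = 1 / (s - x)" for x
  define k' where "k' = (if k = m then 1 else k + 1)"
  have km: "k \<in> {1..m}" "k' \<in> {1..m}" using k assms(1) by (auto simp: k'_def)
  note I_eq = I_set_eq[OF assms(1,7,9) k k'_def, folded T_def]
  have T_inj: "T x = T y \<longleftrightarrow> x = y" if "x \<noteq> s" "y \<noteq> s" for x y
    using that by (auto simp: T_def divide_simps)
  have k_k': "T (\<theta> k) < T (\<theta> k')"
  proof -
    \<comment> \<open>Membership through the weak description, read in the strict one, orders the
      images of \<open>k\<close> and \<open>k'\<close>. Each serves as the second node in the
      separation inequality at the other.\<close>
    have "k \<in> I_set m s \<theta> k" unfolding I_eq(1) using km by simp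
    then show ?thesis unfolding I_eq(2) by simp
  qed
  have quad: "(\<Sum>j\<in>{1..n}. (cmod (w j))\<^sup>2 * poly q (T (lam j))) =
      (\<Sum>i\<in>{1..m}. (cmod (c i))\<^sup>2 * poly q (T (\<theta> i)))"
    if "degree q \<le> 2 * card {1..m} - 2" for q
    unfolding T_def
  proof (rule rational_quadrature_substitution[where N = "2 * m - 2"])
    show "(\<Sum>j\<in>{1..n}. of_real ((cmod (w j))\<^sup>2) *
             (poly p (of_real (lam j)) / of_real (lam j - s) ^ (2 * m - 2))) =
          (\<Sum>i\<in>{1..m}. of_real ((cmod (c i))\<^sup>2) *
             (poly p (of_real (\<theta> i)) / of_real (\<theta> i - s) ^ (2 * m - 2)))"
      if "degree p \<le> 2 * m - 2" for p :: "complex poly"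
      using assms(10) that unfolding Let_def by blast
  qed (use that assms(6,9) in auto)
  have inj: "inj_on (\<lambda>j. T (lam j)) {1..n}" "inj_on (\<lambda>i. T (\<theta> i)) {1..m}"
  proof -
    show "inj_on (\<lambda>j. T (lam j)) {1..n}"
    proof (rule inj_onI)
      fix i j assume ij: "i \<in> {1..n}" "j \<in> {1..n}" "T (lam i) = T (lam j)"
      have "lam i \<noteq> s" "lam j \<noteq> s" using assms(6) ij by metis+
      then show "i = j"
        using strict_mono_on_imp_inj_on[OF assms(3)] ij T_inj by (metis inj_onD)
    qed
    show "inj_on (\<lambda>i. T (\<theta> i)) {1..m}"
    proof (rule inj_onI)
      fix i j assume ij: "i \<in> {1..m}" "j \<in> {1..m}" "T (\<theta> i) = T (\<theta> j)"
      have "\<theta> i \<noteq> s" "\<theta> j \<noteq> s" using assms(9) ij by metis+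
      then show "i = j"
        using strict_mono_on_imp_inj_on[OF assms(7)] ij T_inj by (metis inj_onD)
    qed
  qed
  have pos: "(cmod (w j))\<^sup>2 > 0" if "j \<in> {1..n}" for j using assms(5) that by simp
  have card: "card {1..m} < card {1..n}" using assms(2) by simp
  have "mu n lam w (R_set a b m s \<theta> k) = (\<Sum>j | j \<in> {1..n} \<and> T (lam j) \<le> T (\<theta> k). (cmod (w j))\<^sup>2)"
    unfolding mu_def T_def
    by (intro sum.cong Collect_cong conj_cong refl mem_R_set_iff) (use assms km in auto)
  also have "\<dots> < (\<Sum>i | i \<in> {1..m} \<and> T (\<theta> i) \<le> T (\<theta> k). (cmod (c i))\<^sup>2)"
    by (rule Chebyshev_Markov_Stieltjes[OF _ _ card inj pos quad km k_k']) auto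
  finally have 1: "mu n lam w (R_set a b m s \<theta> k) < (\<Sum>j\<in>I_set m s \<theta> k. (cmod (c j))\<^sup>2)"
    unfolding I_eq(1) .
  have "(\<Sum>i | i \<in> {1..m} \<and> T (\<theta> i) < T (\<theta> k'). (cmod (c i))\<^sup>2) <
      (\<Sum>j | j \<in> {1..n} \<and> T (lam j) < T (\<theta> k'). (cmod (w j))\<^sup>2)"
    by (rule Chebyshev_Markov_Stieltjes_less[OF _ _ card inj pos quad km(2,1) k_k']) auto
  \<comment> \<open>For \<open>k = m\<close> the index \<open>m + 1\<close> of \<open>R_set\<close>
    stands for 1, which is \<open>k'\<close>.\<close>
  also have "\<dots> = mu n lam w (interior (R_set a b m s \<theta> (k + 1)))"
    unfolding mu_def T_def
    by (intro sum.cong Collect_cong conj_cong refl mem_interior_R_set_iff[symmetric])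
      (use assms km in \<open>auto simp: k'_def\<close>)
  finally have 2: "(\<Sum>j\<in>I_set m s \<theta> k. (cmod (c j))\<^sup>2) < mu n lam w (interior (R_set a b m s \<theta> (k + 1)))"
    unfolding I_eq(2) .
  show "mu n lam w (R_set a b m s \<theta> k) < (\<Sum>j\<in>I_set m s \<theta> k. (cmod (c j))\<^sup>2) \<and>
      (\<Sum>j\<in>I_set m s \<theta> k. (cmod (c j))\<^sup>2) < mu n lam w (interior (R_set a b m s \<theta> (k + 1)))"
    using 1 2 by blast
qed

end
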